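(* Let $T,I$ be finite index sets, let $\mathbf{L}_t=(L_t,\leq)$ be an irreducible finite lattice for every $t\in T$, let $\mathbf{L}:=\prod_{t\in T}\mathbf{L}_t$, and let $A=(a_{i,j})\in \mathrm{Mat}_{I\times I}(\mathrm{Res}(\mathbf{L}))$ be invertible. Put $\mathbf{L}_{t,i}:=\mathbf{L}_t$ for $(t,i)\in T\times I$, so that $\mathbf{L}^I=\prod_{(t,i)\in T\times I}\mathbf{L}_{t,i}$. Let $\sigma$ be a permutation of $T\times I$ and let $\varphi_{t,i}:L_{t,i}\rightarrow L_{\sigma^{-1}(t,i)}$, $(t,i)\in T\times I$, be lattice isomorphisms such that $$\pi_t\circ A_i= \varphi_{\sigma(t,i)}\circ \pi_{\sigma(t,i)}\quad\text{for every }(t,i)\in T\times I,$$ where $\pi_t:L\to L_t$ and $\pi_{t,i}:L^I\to L_{t,i}$ are the projections and $A_i:L^I\to L$ is the mapping $A_i((x_j)_{j\in I})=\bigvee_{j\in I}a_{i,j}(x_j)$. Then for the inverse matrix $B=(b_{i,j})$ of $A$, the entry $b_{i,j}$ for $i,j\in I$ is of the form $b_{i,j}=(\check{\varphi}_{i,j,t})_{t\in T}$, i.e. $b_{i,j}(x)=(\check{\varphi}_{i,j,t}(x))_{t\in T}$ for $x\in L$, where the mappings $\check{\varphi}_{i,j,t}:L\to L_t$ are given by $$\check{\varphi}_{i,j,t} = \begin{cases} \varphi_{t,i}^{-1}\circ\pi_s & \text{if there exists } s\in T \text{ with } \sigma^{-1}(t,i)=(s,j),\\ \bar{0}_{\mathbf{L}_t}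 & \text{otherwise,}\end{cases}$$ with $\bar{0}_{\mathbf{L}_t}$ the mapping that maps constantly to the least element $0_{\mathbf{L}_t}$ of $\mathbf{L}_t$.
   Context: A lattice is called irreducible if it has more than one element and is not isomorphic to a direct product of two lattices each having more than one element. For a finite lattice $\mathbf{L}=(L,\leq)$ with least element $0_{\mathbf{L}}$, $\mathrm{Res}(\mathbf{L})$ is the set of residuated mappings $f:L\to L$, i.e. those with $f(x\vee y)=f(x)\vee f(y)$ for all $x,y\in L$ and $f(0_{\mathbf{L}})=0_{\mathbf{L}}$. $(\mathrm{Res}(\mathbf{L}),\vee,\circ)$, with pointwise supremum as addition and composition as multiplication, is a semiring with zero the constant mapping $x\mapsto 0_{\mathbf{L}}$ and one $\mathrm{id}_L$. For a finite index set $I$, $\mathrm{Mat}_{I\times I}(\mathrm{Res}(\mathbf{L}))$ is the semiring of $I\times I$ matrices over this semiring, with entrywise addition and the product $(f_{i,j})\cdot(g_{i,j})=(h_{i,j})$, $h_{i,j}=\bigvee_{k\in I}f_{i,k}\circ g_{k,j}$. A matrix is invertible if it has a two-sided inverse with respect to this product (the identity matrix has $\mathrm{id}_L$ on the diagonal and the zero mapping elsewhere). *)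

theory Defs
  imports "HOL-Combinatorics.Permutations" "HOL-Algebra.Lattice" "HOL-Algebra.Ring"
begin

section \<open>Products and isomorphisms of lattices\<close>

definition prod_lattice :: "'t set \<Rightarrow> ('t \<Rightarrow> 'a gorder) \<Rightarrow> ('t \<Rightarrow> 'a) gorder" where
  "prod_lattice T L =
    \<lparr>carrier = (\<Pi>\<^sub>E t\<in>T. carrier (L t)), eq = (=), le = (\<lambda>x y. \<forall>t\<in>T. x t \<sqsubseteq>\<^bsub>L t\<^esub> y t)\<rparr>"

definition pair_lattice :: "'a gorder \<Rightarrow> 'b gorder \<Rightarrow> ('a \<times> 'b) gorder" where
  "pair_lattice M N =
    \<lparr>carrier = carrier M \<times> carrier N, eq = (=),
     le = (\<lambda>x y. fst x \<sqsubseteq>\<^bsub>M\<^esub> fst y \<and> snd x \<sqsubseteq>\<^bsub>N\<^esub> snd y)\<rparr>"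

definition lattice_iso :: "'a gorder \<Rightarrow> 'b gorder \<Rightarrow> ('a \<Rightarrow> 'b) set" where
  "lattice_iso M N =
    {f. bij_betw f (carrier M) (carrier N) \<and> join_pres M N f \<and> meet_pres M N f}"

definition nontrivial :: "'a gorder \<Rightarrow> bool" where
  "nontrivial L \<longleftrightarrow> (\<exists>x\<in>carrier L. \<exists>y\<in>carrier L. x \<noteq> y)"

text \<open>It is no restriction that the two factors live over the same type as \<open>L\<close>: each factor of
  a product isomorphic to \<open>L\<close> is isomorphic to a sublattice of \<open>L\<close>.\<close>

definition irreducible_lattice :: "'a gorder \<Rightarrow> bool" where
  "irreducible_lattice L \<longleftrightarrow> lattice L \<and> nontrivial L \<and>
    \<not> (\<exists>(M :: 'a gorder) (N :: 'a gorder).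
        lattice M \<and> nontrivial M \<and> lattice N \<and> nontrivial N \<and>
        lattice_iso L (pair_lattice M N) \<noteq> {})"


section \<open>The semiring of residuated mappings\<close>

text \<open>Mappings on the carrier are represented by extensional functions, so that equality
  of elements of the semiring is equality of mappings on the carrier.\<close>

definition Res :: "'a gorder \<Rightarrow> ('a \<Rightarrow> 'a) ring" where
  "Res L =
    \<lparr>carrier = {f \<in> carrier L \<rightarrow>\<^sub>E carrier L. join_pres L L f \<and> f \<bottom>\<^bsub>L\<^esub> = \<bottom>\<^bsub>L\<^esub>},
     mult = compose (carrier L),
     one = (\<lambda>x\<in>carrier L. x),
     zero = (\<lambda>x\<in>carrier L. \<bottom>\<^bsub>L\<^esub>),
     add = (\<lambda>f g. \<lambda>x\<in>carrier L. f x \<squnion>\<^bsub>L\<^esub> g x)\<rparr>"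


section \<open>Matrices over a semiring\<close>

definition Mat :: "'i set \<Rightarrow> 'r ring \<Rightarrow> ('i \<times> 'i \<Rightarrow> 'r) ring" where
  "Mat I R =
    \<lparr>carrier = I \<times> I \<rightarrow>\<^sub>E carrier R,
     mult = (\<lambda>A B. \<lambda>(i, j)\<in>I \<times> I. \<Oplus>\<^bsub>R\<^esub>k\<in>I. A (i, k) \<otimes>\<^bsub>R\<^esub> B (k, j)),
     one = (\<lambda>(i, j)\<in>I \<times> I. if i = j then \<one>\<^bsub>R\<^esub> else \<zero>\<^bsub>R\<^esub>),
     zero = (\<lambda>(i, j)\<in>I \<times> I. \<zero>\<^bsub>R\<^esub>),
     add = (\<lambda>A B. \<lambda>(i, j)\<in>I \<times> I. A (i, j) \<oplus>\<^bsub>R\<^esub> B (i, j))\<rparr>"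

text \<open>The mapping \<open>A\<^sub>i\<close> given by the \<open>i\<close>-th row of a matrix \<open>A\<close> over \<^term>\<open>Res L\<close>.\<close>

definition row_map :: "'i set \<Rightarrow> 'a gorder \<Rightarrow> ('i \<times> 'i \<Rightarrow> 'a \<Rightarrow> 'a) \<Rightarrow> 'i \<Rightarrow> ('i \<Rightarrow> 'a) \<Rightarrow> 'a" where
  "row_map I L A i x = (SSUP\<^bsub>L\<^esub> j:I. A (i, j) (x j))"


section \<open>Projections and the components of the inverse\<close>

definition proj :: "'t \<Rightarrow> ('t \<Rightarrow> 'a) \<Rightarrow> 'a" where
  "proj t x = x t"

text \<open>For a product lattice \<open>L\<close> indexed by \<open>T\<close>, elements of the power of \<open>L\<close> with exponent \<open>I\<close>
  are families of families; their component at \<open>(t, i)\<close> is that at \<open>t\<close> of the \<open>i\<close>-th entry.\<close>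

definition proj2 :: "'t \<times> 'i \<Rightarrow> ('i \<Rightarrow> 't \<Rightarrow> 'a) \<Rightarrow> 'a" where
  "proj2 = (\<lambda>(t, i) x. x i t)"

definition phi_check ::
  "'t set \<Rightarrow> ('t \<Rightarrow> 'a gorder) \<Rightarrow> ('t \<times> 'i \<Rightarrow> 't \<times> 'i) \<Rightarrow> ('t \<times> 'i \<Rightarrow> 'a \<Rightarrow> 'a)
    \<Rightarrow> 'i \<Rightarrow> 'i \<Rightarrow> 't \<Rightarrow> ('t \<Rightarrow> 'a) \<Rightarrow> 'a" where
  "phi_check T L \<sigma> \<phi> i j t =
    (if \<exists>s\<in>T. inv_into UNIV \<sigma> (t, i) = (s, j)
     then inv_into (carrier (L t)) (\<phi> (t, i)) \<circ>
            proj (THE s. s \<in> T \<and> inv_into UNIV \<sigma> (t, i) = (s, j))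
     else (\<lambda>_. \<bottom>\<^bsub>L t\<^esub>))"

end

theory Submission
  imports Defs
begin

text \<open>Let \<open>Y\<close> be any right inverse of \<open>A\<close>. Evaluating \<open>A \<cdot> Y = 1\<close> at \<open>x\<close> shows that the rows of
  \<open>A\<close> map the \<open>j\<close>-th column of \<open>Y\<close>, evaluated at \<open>x\<close>, to the vector with \<open>x\<close> in position \<open>j\<close> and
  zero elsewhere. Since the rows of \<open>A\<close> act componentwise through the isomorphisms \<open>\<phi>\<close> and the
  permutation \<open>\<sigma>\<close>, every component of the column can be solved for. So right inverses of \<open>A\<close> are
  unique and given by the claimed formula, without recourse to associativity of the matrix
  product.\<close>

section \<open>Lattices with a least element\<close>

text \<open>\<open>\<bottom>\<close> is a choice term whose laws depend on the existence of a least
  element; the locale adds that existence to the lattice axioms.\<close>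

locale lattice_with_bottom = lattice L + weak_partial_order_bottom L
  for L :: "'a gorder" (structure)

text \<open>The infimum of a finite nonempty carrier lies in the carrier and below each of its
  elements.\<close>

lemma (in weak_lower_semilattice) finite_bottom_exists:
  assumes "finite (carrier L)" "carrier L \<noteq> {}"
  shows "\<exists>x. least L x (carrier L)"
proof -
  have "greatest L (\<Sqinter>carrier L) (Lower L (carrier L))"
    using assms by (intro finite_inf_greatest) auto
  then show ?thesis
    by (auto simp: least_def greatest_def Lower_def)
qed

lemma irreducible_finite_lattice_with_bottom:
  assumes "irreducible_lattice L" "finite (carrier L)"
  shows "lattice_with_bottom L"
proof -
  interpret lattice L
    using assms by (simp add: irreducible_lattice_def)
  show ?thesis
    using assms finite_bottom_exists
    by unfold_locales (auto simp: irreducible_lattice_def nontrivial_def)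
qed

context lattice_with_bottom
begin

lemma bottom_eqI:
  "\<lbrakk>b \<in> carrier L; \<And>x. x \<in> carrier L \<Longrightarrow> b \<sqsubseteq> x\<rbrakk> \<Longrightarrow> b = \<bottom>"
  by (metis bottom_closed bottom_lower le_antisym)

lemma join_bottom_left: "x \<in> carrier L \<Longrightarrow> \<bottom> \<squnion> x = x"
  by (metis bottom_closed bottom_lower le_iff_meet)

text \<open>By surjectivity every \<open>y\<close> is some \<open>f x\<close>, and the join of
  \<open>f \<bottom>\<close> with \<open>f x\<close> is
  \<open>f (\<bottom> \<squnion> x) = f x\<close>, so \<open>f \<bottom>\<close> is below
  \<open>y\<close>.\<close>

lemma lattice_iso_bottom:
  assumes "f \<in> lattice_iso L M" "lattice_with_bottom M"
  shows "f \<bottom> = \<bottom>\<^bsub>M\<^esub>"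
proof -
  interpret M: lattice_with_bottom M by fact
  have bij: "bij_betw f (carrier L) (carrier M)" and join: "join_pres L M f"
    using assms by (auto simp: lattice_iso_def)
  show ?thesis
  proof (rule M.bottom_eqI)
    show b: "f \<bottom> \<in> carrier M"
      using bij_betwE[OF bij] bottom_closed by blast
    fix y assume y: "y \<in> carrier M"
    then obtain x where x: "x \<in> carrier L" "f x = y"
      using bij by (metis bij_betw_imp_surj_on imageE)
    have "f \<bottom> \<squnion>\<^bsub>M\<^esub> y = f (\<bottom> \<squnion> x)"
      using join x by (simp add: join_pres_def)
    then show "f \<bottom> \<sqsubseteq>\<^bsub>M\<^esub> y"
      \<comment> \<open>\<open>le_iff_meet\<close> characterises the order by joins.\<close>
      using M.le_iff_meet b y x join_bottom_left by simp
  qed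
qed

end

text \<open>The order is componentwise, so the family of bottoms is least. Being a partial order
  makes least elements unique, which identifies the choice term \<open>\<bottom>\<close>.\<close>

lemma prod_lattice_bottom:
  assumes "\<And>t. t \<in> T \<Longrightarrow> lattice_with_bottom (L t)" "partial_order (prod_lattice T L)"
  shows "least (prod_lattice T L) (\<lambda>t\<in>T. \<bottom>\<^bsub>L t\<^esub>) (carrier (prod_lattice T L))"
    and "\<bottom>\<^bsub>prod_lattice T L\<^esub> = (\<lambda>t\<in>T. \<bottom>\<^bsub>L t\<^esub>)"
proof -
  interpret P: partial_order "prod_lattice T L" by fact
  have bot: "\<bottom>\<^bsub>L t\<^esub> \<in> carrier (L t)" "\<And>y. y \<in> carrier (L t) \<Longrightarrow> \<bottom>\<^bsub>L t\<^esub> \<sqsubseteq>\<^bsub>L t\<^esub> y" if "t \<in> T" for t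
  proof -
    interpret lattice_with_bottom "L t" using assms that by blast
    show "\<bottom>\<^bsub>L t\<^esub> \<in> carrier (L t)" "\<And>y. y \<in> carrier (L t) \<Longrightarrow> \<bottom>\<^bsub>L t\<^esub> \<sqsubseteq>\<^bsub>L t\<^esub> y" by auto
  qed
  show least: "least (prod_lattice T L) (\<lambda>t\<in>T. \<bottom>\<^bsub>L t\<^esub>) (carrier (prod_lattice T L))"
    using bot by (fastforce simp: least_def prod_lattice_def)
  show "\<bottom>\<^bsub>prod_lattice T L\<^esub> = (\<lambda>t\<in>T. \<bottom>\<^bsub>L t\<^esub>)"
    unfolding bottom_def[of "prod_lattice T L"]
    using least P.least_unique[OF _ least] by (rule some_equality)
qed

section \<open>Sums and products of residuated mappings\<close>

lemma Mat_entry_closed: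
  "\<lbrakk>A \<in> carrier (Mat I R); i \<in> I; j \<in> I\<rbrakk> \<Longrightarrow> A (i, j) \<in> carrier R"
  by (auto simp: Mat_def)

context lattice_with_bottom
begin

lemma Res_closed: "\<lbrakk>f \<in> carrier (Res L); x \<in> carrier L\<rbrakk> \<Longrightarrow> f x \<in> carrier L"
  by (auto simp: Res_def)

lemma Res_add_apply: "x \<in> carrier L \<Longrightarrow> (f \<oplus>\<^bsub>Res L\<^esub> g) x = f x \<squnion> g x"
  by (simp add: Res_def)

lemma Res_mult_apply: "x \<in> carrier L \<Longrightarrow> (f \<otimes>\<^bsub>Res L\<^esub> g) x = f (g x)"
  by (simp add: Res_def compose_def)

lemma Res_mult_closed:
  assumes "f \<in> carrier (Res L)" "g \<in> carrier (Res L)"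
  shows "f \<otimes>\<^bsub>Res L\<^esub> g \<in> carrier (Res L)"
  using assms by (auto simp: Res_def compose_def join_pres_def PiE_iff Pi_iff)

text \<open>Entries of a matrix product are formed with \<open>finsum\<close>, whose laws rest on a
  commutative additive monoid.\<close>

lemma abelian_monoid_Res: "abelian_monoid (Res L)"
proof (rule abelian_monoidI)
  show "f \<oplus>\<^bsub>Res L\<^esub> g \<in> carrier (Res L)"
    if "f \<in> carrier (Res L)" "g \<in> carrier (Res L)" for f g
  proof -
    have f: "f x \<in> carrier L" "g x \<in> carrier L" if "x \<in> carrier L" for x
      using that \<open>f \<in> carrier (Res L)\<close> \<open>g \<in> carrier (Res L)\<close> by (auto simp: Res_def)
    have "f (x \<squnion> y) \<squnion> g (x \<squnion> y) = (f x \<squnion> g x) \<squnion> (f y \<squnion> g y)"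
      if xy: "x \<in> carrier L" "y \<in> carrier L" for x y
    proof -
      have "f (x \<squnion> y) = f x \<squnion> f y" "g (x \<squnion> y) = g x \<squnion> g y"
        using xy \<open>f \<in> carrier (Res L)\<close> \<open>g \<in> carrier (Res L)\<close> by (auto simp: Res_def join_pres_def)
      then show ?thesis
        using f[OF xy(1)] f[OF xy(2)]
        by (simp add: join_assoc) (metis join_assoc join_comm)
    qed
    moreover have "f \<bottom> = \<bottom>" "g \<bottom> = \<bottom>"
      using that by (auto simp: Res_def)
    ultimately show ?thesis
      using f join_bottom_left lattice_axioms by (auto simp: Res_def join_pres_def)
  qed
  show "\<zero>\<^bsub>Res L\<^esub> \<in> carrier (Res L)"
    using join_bottom_left lattice_axioms by (auto simp: Res_def join_pres_def)
  show "(f \<oplus>\<^bsub>Res L\<^esub> g) \<oplus>\<^bsub>Res L\<^esub> h = f \<oplus>\<^bsub>Res L\<^esub> (g \<oplus>\<^bsub>Res L\<^esub> h)"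
    if "f \<in> carrier (Res L)" "g \<in> carrier (Res L)" "h \<in> carrier (Res L)" for f g h
    using that by (auto simp: Res_def join_assoc PiE_iff intro!: restrict_ext)
  show "\<zero>\<^bsub>Res L\<^esub> \<oplus>\<^bsub>Res L\<^esub> f = f" if "f \<in> carrier (Res L)" for f
    using that join_bottom_left by (auto simp: Res_def fun_eq_iff PiE_iff extensional_def)
  show "f \<oplus>\<^bsub>Res L\<^esub> g = g \<oplus>\<^bsub>Res L\<^esub> f"
    if "f \<in> carrier (Res L)" "g \<in> carrier (Res L)" for f g
    using that by (auto simp: Res_def join_comm[of L])
qed

sublocale Res: abelian_monoid "Res L"
  by (rule abelian_monoid_Res)

text \<open>Stated with \<open>least\<close> and \<open>Upper\<close> so that the induction uses the
  universal property of suprema and no choice term. The empty sum fits, since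
  \<open>\<bottom>\<close> is the least upper bound of the empty set.\<close>

lemma finsum_Res_least:
  assumes "finite K" "f \<in> K \<rightarrow> carrier (Res L)" "x \<in> carrier L"
  shows "least L ((\<Oplus>\<^bsub>Res L\<^esub>k\<in>K. f k) x) (Upper L ((\<lambda>k. f k x) ` K))"
  using assms(1,2)
proof (induction K)
  case empty
  have "\<zero>\<^bsub>Res L\<^esub> x = \<bottom>"
    using \<open>x \<in> carrier L\<close> by (simp add: Res_def)
  then show ?case
    using bottom_least by simp
next
  case (insert k K)
  let ?s = "(\<Oplus>\<^bsub>Res L\<^esub>k\<in>K. f k) x"
  have fk: "f k \<in> carrier (Res L)" and fK: "f \<in> K \<rightarrow> carrier (Res L)"
    using insert.prems by auto
  have least: "least L ?s (Upper L ((\<lambda>k. f k x) ` K))"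
    using insert.IH fK by simp
  have sums: "(\<Oplus>\<^bsub>Res L\<^esub>k\<in>insert k K. f k) x = f k x \<squnion> ?s"
    using insert.hyps fk fK \<open>x \<in> carrier L\<close> Res.finsum_insert Res_add_apply by simp
  have cl: "f k x \<in> carrier L" "?s \<in> carrier L"
    using fk fK Res_closed \<open>x \<in> carrier L\<close> by auto
  have below: "f l x \<sqsubseteq> ?s" if "l \<in> K" for l
    using that fK Res_closed \<open>x \<in> carrier L\<close> by (intro least_Upper_above[OF least]) auto
  show ?case
    unfolding sums
  proof (rule least_UpperI)
    fix y assume "y \<in> (\<lambda>k. f k x) ` insert k K"
    then consider "y = f k x" | l where "l \<in> K" "y = f l x" by auto
    then show "y \<sqsubseteq> f k x \<squnion> ?s"
    proof cases
      case 1
      then show ?thesis using cl join_left by simp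
    next
      case 2
      then have "y \<sqsubseteq> ?s" "y \<in> carrier L"
        using below Res_closed[OF funcset_mem[OF fK] \<open>x \<in> carrier L\<close>] by simp_all
      then show ?thesis
        using cl join_right le_trans by (meson join_closed)
    qed
  next
    fix y assume y: "y \<in> Upper L ((\<lambda>k. f k x) ` insert k K)"
    then have "y \<in> Upper L ((\<lambda>k. f k x) ` K)"
      by (auto simp: Upper_def)
    then have "?s \<sqsubseteq> y"
      using least by (simp add: least_def)
    moreover have "f k x \<sqsubseteq> y" "y \<in> carrier L"
      using y cl by (auto simp: Upper_def)
    ultimately show "f k x \<squnion> ?s \<sqsubseteq> y"
      using cl join_le by simp
  qed (use cl fk fK Res_closed \<open>x \<in> carrier L\<close> in auto)
qed

lemma finsum_Res_apply:
  assumes "finite K" "f \<in> K \<rightarrow> carrier (Res L)" "x \<in> carrier L"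
  shows "(\<Oplus>\<^bsub>Res L\<^esub>k\<in>K. f k) x = (SSUP k:K. f k x)"
  unfolding supr_def sup_def
  by (rule some_equality[symmetric]) (use finsum_Res_least[OF assms] least_unique in blast)+

text \<open>Entry \<open>(i, j)\<close> of the product, evaluated at \<open>x\<close>, is the
  supremum that \<open>row_map\<close> forms from column \<open>j\<close> of \<open>Y\<close>. The
  matrix equation thus becomes a statement about row maps, which are what the theorem ties to
  \<open>\<phi>\<close> and \<open>\<sigma>\<close>.\<close>

lemma row_map_right_inverse:
  assumes "finite I" "A \<in> carrier (Mat I (Res L))" "Y \<in> carrier (Mat I (Res L))"
    and "A \<otimes>\<^bsub>Mat I (Res L)\<^esub> Y = \<one>\<^bsub>Mat I (Res L)\<^esub>"
    and "i \<in> I" "j \<in> I" "x \<in> carrier L"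
  shows "row_map I L A i (\<lambda>k\<in>I. Y (k, j) x) = (if i = j then x else \<bottom>)"
proof -
  have AY: "A (i, k) \<otimes>\<^bsub>Res L\<^esub> Y (k, j) \<in> carrier (Res L)" if "k \<in> I" for k
    using Mat_entry_closed[OF assms(2,5) that] Mat_entry_closed[OF assms(3) that assms(6)]
    by (rule Res_mult_closed)
  have "row_map I L A i (\<lambda>k\<in>I. Y (k, j) x) = (SSUP k:I. (A (i, k) \<otimes>\<^bsub>Res L\<^esub> Y (k, j)) x)"
    using \<open>x \<in> carrier L\<close> by (simp add: row_map_def supr_def Res_mult_apply)
  also have "\<dots> = (\<Oplus>\<^bsub>Res L\<^esub>k\<in>I. A (i, k) \<otimes>\<^bsub>Res L\<^esub> Y (k, j)) x"
    using assms AY by (subst finsum_Res_apply) auto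
  also have "\<dots> = (A \<otimes>\<^bsub>Mat I (Res L)\<^esub> Y) (i, j) x"
    using assms(5,6) by (simp add: Mat_def)
  also have "\<dots> = (if i = j then x else \<bottom>)"
    using assms(4-7) by (simp add: Mat_def) (simp add: Res_def)
  finally show ?thesis .
qed

end

section \<open>The inverse matrix\<close>

theorem proposition4p5:
  fixes T :: "'t set" and I :: "'i set"
    and L :: "'t \<Rightarrow> 'a gorder"
    and A B :: "'i \<times> 'i \<Rightarrow> ('t \<Rightarrow> 'a) \<Rightarrow> ('t \<Rightarrow> 'a)"
    and \<sigma> :: "'t \<times> 'i \<Rightarrow> 't \<times> 'i"
    and \<phi> :: "'t \<times> 'i \<Rightarrow> 'a \<Rightarrow> 'a"
  assumes "finite T" and "finite I"
    and "\<And>t. t \<in> T \<Longrightarrow> irreducible_lattice (L t) \<and> finite (carrier (L t))"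
    and "A \<in> Units (Mat I (Res (prod_lattice T L)))"
    and "\<sigma> permutes (T \<times> I)"
    and "\<And>p. p \<in> T \<times> I \<Longrightarrow> \<phi> p \<in> lattice_iso (L (fst p)) (L (fst (inv_into UNIV \<sigma> p)))"
    and "\<And>t i x. \<lbrakk>t \<in> T; i \<in> I; x \<in> carrier (prod_lattice I (\<lambda>_. prod_lattice T L))\<rbrakk> \<Longrightarrow>
           (proj t \<circ> row_map I (prod_lattice T L) A i) x = (\<phi> (\<sigma> (t, i)) \<circ> proj2 (\<sigma> (t, i))) x"
    and "B = inv\<^bsub>Mat I (Res (prod_lattice T L))\<^esub> A"
  shows "\<forall>i\<in>I. \<forall>j\<in>I. \<forall>x\<in>carrier (prod_lattice T L).
           B (i, j) x = (\<lambda>t\<in>T. phi_check T L \<sigma> \<phi> i j t x)"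
proof (intro ballI)
  fix i j x
  assume ij: "i \<in> I" "j \<in> I" and x: "x \<in> carrier (prod_lattice T L)"
  let ?P = "prod_lattice T L"
  let ?M = "Mat I (Res ?P)"
  have L: "lattice_with_bottom (L t)" if "t \<in> T" for t
    using assms(3) that irreducible_finite_lattice_with_bottom by blast
  have A: "A \<in> carrier ?M"
    using assms(4) by (simp add: Units_def)
  \<comment> \<open>\<open>join_pres\<close> includes that its source and target are lattices, so a
    single entry of \<open>A\<close> shows the product to be a lattice.\<close>
  then have "A (i, i) \<in> carrier (Res ?P)"
    by (rule Mat_entry_closed[OF _ ij(1) ij(1)])
  then interpret P: lattice ?P
    by (simp add: Res_def join_pres_def)
  interpret P: lattice_with_bottom ?P
    using prod_lattice_bottom(1)[of T L] L P.partial_order_axioms by unfold_locales blast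
  have bottom: "\<bottom>\<^bsub>?P\<^esub> = (\<lambda>t\<in>T. \<bottom>\<^bsub>L t\<^esub>)"
    using L P.partial_order_axioms by (intro prod_lattice_bottom(2))
  have formula: "Y (k, l) y = (\<lambda>t\<in>T. phi_check T L \<sigma> \<phi> k l t y)"
    if Y: "Y \<in> carrier ?M" "A \<otimes>\<^bsub>?M\<^esub> Y = \<one>\<^bsub>?M\<^esub>" and kl: "k \<in> I" "l \<in> I" and y: "y \<in> carrier ?P"
    for Y k l y
  proof -
    have cl: "Y (h, l) y \<in> carrier ?P" if "h \<in> I" for h
      using P.Res_closed[OF Mat_entry_closed[OF Y(1) that kl(2)] y] .
    have "Y (k, l) y s = phi_check T L \<sigma> \<phi> k l s y" if s: "s \<in> T" for s
    proof -
      \<comment> \<open>The pair \<open>(t, h)\<close> is the output position that reads input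
        position \<open>(s, k)\<close>: component \<open>t\<close> of row \<open>h\<close> applied
        to a vector \<open>v\<close> is \<open>\<phi> (s, k) (v k s)\<close>.\<close>
      obtain t h where th: "inv_into UNIV \<sigma> (s, k) = (t, h)" by fastforce
      then have \<sigma>: "\<sigma> (t, h) = (s, k)"
        using assms(5) by (metis permutes_inverses(1))
      have tT: "t \<in> T" "h \<in> I"
        using permutes_in_image[OF assms(5), of "(t, h)"] \<sigma> s kl by auto
      interpret Ls: lattice_with_bottom "L s" using L s .
      have iso: "\<phi> (s, k) \<in> lattice_iso (L s) (L t)"
        using assms(6)[of "(s, k)"] s kl th by simp
      have c: "Y (k, l) y s \<in> carrier (L s)"
        using cl[OF kl(1)] s by (auto simp: prod_lattice_def)
      have inj: "inj_on (\<phi> (s, k)) (carrier (L s))"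
        using iso by (simp add: lattice_iso_def bij_betw_def)
      let ?v = "\<lambda>h\<in>I. Y (h, l) y"
      have "?v \<in> carrier (prod_lattice I (\<lambda>_. ?P))"
        using cl by (simp add: prod_lattice_def[of I])
      then have "\<phi> (s, k) (Y (k, l) y s) = row_map I ?P A h ?v t"
        using assms(7)[OF tT] \<sigma> kl by (simp add: proj_def proj2_def)
      also have "\<dots> = (if h = l then y else \<bottom>\<^bsub>?P\<^esub>) t"
        using P.row_map_right_inverse[OF assms(2) A Y tT(2) kl(2) y] by simp
      \<comment> \<open>The bottom of \<open>L t\<close> is rewritten as an image under
        \<open>\<phi> (s, k)\<close>, so that injectivity can cancel the isomorphism when
        \<open>h\<close> differs from \<open>l\<close>.\<close>
      finally have eq: "\<phi> (s, k) (Y (k, l) y s) = (if h = l then y t else \<phi> (s, k) \<bottom>\<^bsub>L s\<^esub>)"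
        using bottom tT Ls.lattice_iso_bottom[OF iso L[OF tT(1)]] by simp
      show ?thesis
      proof (cases "h = l")
        case True
        moreover have "(THE u. u \<in> T \<and> inv_into UNIV \<sigma> (s, k) = (u, l)) = t"
          using th tT True by auto
        ultimately show ?thesis
          using eq th tT inv_into_f_f[OF inj c] by (auto simp: phi_check_def proj_def)
      next
        case False
        then have "Y (k, l) y s = \<bottom>\<^bsub>L s\<^esub>"
          using eq inj_onD[OF inj _ c Ls.bottom_closed] by simp
        then show ?thesis
          using False th by (auto simp: phi_check_def)
      qed
    qed
    then show ?thesis
      using cl[OF kl(1)] by (auto simp: prod_lattice_def fun_eq_iff PiE_iff extensional_def)
  qed
  \<comment> \<open>The formula fixes all values of all entries on the carrier; matrices and their
    entries are extensional, so they coincide.\<close>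
  have unique: "Y = Z"
    if Y: "Y \<in> carrier ?M" "A \<otimes>\<^bsub>?M\<^esub> Y = \<one>\<^bsub>?M\<^esub>"
      and Z: "Z \<in> carrier ?M" "A \<otimes>\<^bsub>?M\<^esub> Z = \<one>\<^bsub>?M\<^esub>" for Y Z
  proof (rule PiE_ext)
    show "Y \<in> I \<times> I \<rightarrow>\<^sub>E carrier (Res ?P)" "Z \<in> I \<times> I \<rightarrow>\<^sub>E carrier (Res ?P)"
      using Y Z by (simp_all add: Mat_def)
    then have "Y p \<in> carrier (Res ?P)" "Z p \<in> carrier (Res ?P)" if "p \<in> I \<times> I" for p
      using that by auto
    then show "Y p = Z p" if "p \<in> I \<times> I" for p
      using that formula[OF Y] formula[OF Z]
      by (intro PiE_ext[of _ "carrier ?P" "\<lambda>_. carrier ?P"]) (auto simp: Res_def)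
  qed
  obtain Y where Y: "Y \<in> carrier ?M" "A \<otimes>\<^bsub>?M\<^esub> Y = \<one>\<^bsub>?M\<^esub>" "Y \<otimes>\<^bsub>?M\<^esub> A = \<one>\<^bsub>?M\<^esub>"
    using assms(4) by (auto simp: Units_def)
  \<comment> \<open>The inverse is a definite description: \<open>Y\<close> satisfies it, and the
    right-inverse half already forces uniqueness.\<close>
  have "B = Y"
    unfolding assms(8) m_inv_def by (rule the_equality) (use Y unique in blast)+
  then show "B (i, j) x = (\<lambda>t\<in>T. phi_check T L \<sigma> \<phi> i j t x)"
    using formula[OF Y(1,2) ij x] by simp
qed

end
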